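(* Let $I\subseteq\mathbb{R}$ be an interval, let $a,b\in I$ with $0\leq a<b$, let $x,y,z$ satisfy $a\leq x\leq y\leq z\leq b$, and let $f:I\rightarrow\mathbb{R}$ be an $M$-Lipschitzian function. Let $\alpha>0$, let $\lambda,\eta,\mu\in[0,1]$ with $\lambda+\eta+\mu=1$, and put $V_{1}=(1-\lambda)a+\lambda b$, $V_{2}=\mu a+(\lambda+\eta)b$. Define $V_{\alpha,\lambda,\eta,\mu}(x,y,z)$ as follows. (1) If $V_{1}\leq V_{2}\leq x\leq y\leq z$ or $V_{1}\leq x\leq V_{2}\leq y\leq z$, then $$V_{\alpha,\lambda,\eta,\mu}(x,y,z)=(V_{1}-a)^{\alpha}\left[\frac{x-a}{\alpha}-\frac{V_{1}-a}{\alpha+1}\right]+(V_{2}-V_{1})^{\alpha}\left[\frac{y-V_{2}}{\alpha}+\frac{V_{2}-V_{1}}{\alpha+1}\right]+\frac{2(b-z)^{\alpha+1}}{\alpha(\alpha+1)}+(b-V_{2})^{\alpha}\left[\frac{b-V_{2}}{\alpha+1}-\frac{b-z}{\alpha}\right].$$ (2) If $V_{1}\leq x\leq y\leq V_{2}\leq z$, then $$V_{\alpha,\lambda,\eta,\mu}(x,y,z)=(V_{1}-a)^{\alpha}\left[\frac{x-a}{\alpha}-\frac{V_{1}-a}{\alpha+1}\right]+\frac{2(V_{2}-y)^{\alpha+1}}{\alpha(\alpha+1)}+(V_{2}-V_{1})^{\alpha}\left[\frac{V_{2}-V_{1}}{\alpha+1}-\frac{V_{2}-y}{\alpha}\right]+\frac{2(b-z)^{\alpha+1}}{\alpha(\alpha+1)}+(b-V_{2})^{\alpha}\left[\frac{b-V_{2}}{\alpha+1}-\frac{b-z}{\alpha}\right].$$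 (3) If $V_{1}\leq x\leq y\leq z\leq V_{2}$, then $$V_{\alpha,\lambda,\eta,\mu}(x,y,z)=(V_{1}-a)^{\alpha}\left[\frac{x-a}{\alpha}-\frac{V_{1}-a}{\alpha+1}\right]+\frac{2(V_{2}-y)^{\alpha+1}}{\alpha(\alpha+1)}+(V_{2}-V_{1})^{\alpha}\left[\frac{V_{2}-V_{1}}{\alpha+1}-\frac{V_{2}-y}{\alpha}\right]+(b-V_{2})^{\alpha}\left[\frac{b-z}{\alpha}-\frac{b-V_{2}}{\alpha+1}\right].$$ (4) If $x\leq V_{1}\leq V_{2}\leq y\leq z$, then $$V_{\alpha,\lambda,\eta,\mu}(x,y,z)=\frac{2(x-a)^{\alpha+1}}{\alpha(\alpha+1)}+(V_{1}-a)^{\alpha}\left[\frac{V_{1}-a}{\alpha+1}-\frac{x-a}{\alpha}\right]+(V_{2}-V_{1})^{\alpha}\left[\frac{y-V_{2}}{\alpha}+\frac{V_{2}-V_{1}}{\alpha+1}\right]+\frac{2(b-z)^{\alpha+1}}{\alpha(\alpha+1)}+(b-V_{2})^{\alpha}\left[\frac{b-V_{2}}{\alpha+1}-\frac{b-z}{\alpha}\right].$$ (5) If $x\leq V_{1}\leq y\leq V_{2}\leq z$, then $$V_{\alpha,\lambda,\eta,\mu}(x,y,z)=\frac{2(x-a)^{\alpha+1}}{\alpha(\alpha+1)}+(V_{1}-a)^{\alpha}\left[\frac{V_{1}-a}{\alpha+1}-\frac{x-a}{\alpha}\right]+\frac{2(V_{2}-y)^{\alpha+1}}{\alpha(\alpha+1)}+(V_{2}-V_{1})^{\alpha}\left[\frac{V_{2}-V_{1}}{\alpha+1}-\frac{V_{2}-y}{\alpha}\right]+\frac{2(b-z)^{\alpha+1}}{\alpha(\alpha+1)}+(b-V_{2})^{\alpha}\left[\frac{b-V_{2}}{\alpha+1}-\frac{b-z}{\alpha}\right].$$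 (6) If $x\leq V_{1}\leq y\leq z\leq V_{2}$, then $$V_{\alpha,\lambda,\eta,\mu}(x,y,z)=\frac{2(x-a)^{\alpha+1}}{\alpha(\alpha+1)}+(V_{1}-a)^{\alpha}\left[\frac{V_{1}-a}{\alpha+1}-\frac{x-a}{\alpha}\right]+\frac{2(V_{2}-y)^{\alpha+1}}{\alpha(\alpha+1)}+(V_{2}-V_{1})^{\alpha}\left[\frac{V_{2}-V_{1}}{\alpha+1}-\frac{V_{2}-y}{\alpha}\right]+(b-V_{2})^{\alpha}\left[\frac{b-z}{\alpha}-\frac{b-V_{2}}{\alpha+1}\right].$$ (7) If $x\leq y\leq V_{1}\leq V_{2}\leq z$, then $$V_{\alpha,\lambda,\eta,\mu}(x,y,z)=\frac{2(x-a)^{\alpha+1}}{\alpha(\alpha+1)}+(V_{1}-a)^{\alpha}\left[\frac{V_{1}-a}{\alpha+1}-\frac{x-a}{\alpha}\right]+(V_{2}-V_{1})^{\alpha}\left[\frac{V_{2}-V_{1}}{\alpha+1}-\frac{V_{2}-y}{\alpha}\right]+\frac{2(b-z)^{\alpha+1}}{\alpha(\alpha+1)}+(b-V_{2})^{\alpha}\left[\frac{b-V_{2}}{\alpha+1}-\frac{b-z}{\alpha}\right].$$ (8) If $x\leq y\leq V_{1}\leq z\leq V_{2}$ or $x\leq y\leq z\leq V_{1}\leq V_{2}$, then $$V_{\alpha,\lambda,\eta,\mu}(x,y,z)=\frac{2(x-a)^{\alpha+1}}{\alpha(\alpha+1)}+(V_{1}-a)^{\alpha}\left[\frac{V_{1}-a}{\alpha+1}-\frac{x-a}{\alpha}\right]+(V_{2}-V_{1})^{\alpha}\left[\frac{V_{2}-V_{1}}{\alpha+1}-\frac{V_{2}-y}{\alpha}\right]+(b-V_{2})^{\alpha}\left[\frac{b-z}{\alpha}-\frac{b-V_{2}}{\alpha+1}\right].$$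 Then $$\left|\lambda^{\alpha}f(x)+\eta^{\alpha}f(y)+\mu^{\alpha}f(z)-\frac{\Gamma(\alpha+1)}{(b-a)^{\alpha}}\left[J_{V_{1}-}^{\alpha}f(a)+J_{V_{1}+}^{\alpha}f(V_{2})+J_{V_{2}+}^{\alpha}f(b)\right]\right|\leq\frac{\alpha M\,V_{\alpha,\lambda,\eta,\mu}(x,y,z)}{(b-a)^{\alpha}}.$$
   Context: A function $f:I\rightarrow\mathbb{R}$ on an interval $I$ is called $M$-Lipschitzian, with $M\geq 0$, if $|f(s)-f(t)|\leq M|s-t|$ for all $s,t\in I$. Riemann-Liouville fractional integrals of order $\alpha>0$: for real $0\leq c<d$ and $f$ integrable on $[c,d]$, $$J_{c+}^{\alpha}f(d)=\frac{1}{\Gamma(\alpha)}\int_{c}^{d}(d-t)^{\alpha-1}f(t)\,dt,\qquad J_{d-}^{\alpha}f(c)=\frac{1}{\Gamma(\alpha)}\int_{c}^{d}(t-c)^{\alpha-1}f(t)\,dt,$$ where $\Gamma$ is the Gamma function. When $c=d$ these integrals are taken to be $0$. Also $0^{\alpha}=0$ for $\alpha>0$.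
   Formalization: In cases (7) and (8) the middle bracket is taken with the opposite sign, (V2-V1)^α[(V2-y)/α-(V2-V1)/(α+1)]; as printed V can be negative (a=0, b=1, α=1, λ=μ=1/10, η=8/10, x=y=1/20, z=9/10), so the bound fails for f=0, M=1. *)

theory Defs
  imports "HOL-Analysis.Analysis"
begin

definition RL_left :: "real \<Rightarrow> real \<Rightarrow> (real \<Rightarrow> real) \<Rightarrow> real \<Rightarrow> real" where
  "RL_left \<alpha> c f d =
     (1 / Gamma \<alpha>) * (LINT t:{c..d}|lebesgue. (d - t) powr (\<alpha> - 1) * f t)"

definition RL_right :: "real \<Rightarrow> real \<Rightarrow> (real \<Rightarrow> real) \<Rightarrow> real \<Rightarrow> real" where
  "RL_right \<alpha> d f c =
     (1 / Gamma \<alpha>) * (LINT t:{c..d}|lebesgue. (t - c) powr (\<alpha> - 1) * f t)"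

definition node1 :: "real \<Rightarrow> real \<Rightarrow> real \<Rightarrow> real" where
  "node1 lam a b = (1 - lam) * a + lam * b"

definition node2 :: "real \<Rightarrow> real \<Rightarrow> real \<Rightarrow> real \<Rightarrow> real \<Rightarrow> real" where
  "node2 lam \<eta> \<mu> a b = \<mu> * a + (lam + \<eta>) * b"

(* In the two branches with y <= V1 the middle summand is
     (V2 - V1)^alpha * ((V2 - y) / alpha - (V2 - V1) / (alpha + 1)),
   the value of the integral of (V2 - t)^(alpha - 1) * |t - y| over [V1, V2].
   The source prints this bracket with the opposite sign; that makes the bound
   false (printed_sign_negative below) and makes the cases disagree at y = V1.

   The regions overlap on their boundaries, but the formulas agree there, and
   for x <= y <= z, V1 <= V2 the regions are exhaustive (Vfun_cases below,
   Vfun_exhaustive), so neither the order of the branches nor the final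
   "undefined" matters. *)
definition Vfun :: "real \<Rightarrow> real \<Rightarrow> real \<Rightarrow> real \<Rightarrow> real \<Rightarrow> real \<Rightarrow> real \<Rightarrow> real \<Rightarrow> real \<Rightarrow> real" where
  "Vfun \<alpha> lam \<eta> \<mu> a b x y z =
     (let V1 = node1 lam a b; V2 = node2 lam \<eta> \<mu> a b in
      if (V1 \<le> V2 \<and> V2 \<le> x \<and> x \<le> y \<and> y \<le> z) \<or> (V1 \<le> x \<and> x \<le> V2 \<and> V2 \<le> y \<and> y \<le> z) then
        (V1 - a) powr \<alpha> * ((x - a) / \<alpha> - (V1 - a) / (\<alpha> + 1))
        + (V2 - V1) powr \<alpha> * ((y - V2) / \<alpha> + (V2 - V1) / (\<alpha> + 1))
        + 2 * (b - z) powr (\<alpha> + 1) / (\<alpha> * (\<alpha> + 1))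
        + (b - V2) powr \<alpha> * ((b - V2) / (\<alpha> + 1) - (b - z) / \<alpha>)
      else if V1 \<le> x \<and> x \<le> y \<and> y \<le> V2 \<and> V2 \<le> z then
        (V1 - a) powr \<alpha> * ((x - a) / \<alpha> - (V1 - a) / (\<alpha> + 1))
        + 2 * (V2 - y) powr (\<alpha> + 1) / (\<alpha> * (\<alpha> + 1))
        + (V2 - V1) powr \<alpha> * ((V2 - V1) / (\<alpha> + 1) - (V2 - y) / \<alpha>)
        + 2 * (b - z) powr (\<alpha> + 1) / (\<alpha> * (\<alpha> + 1))
        + (b - V2) powr \<alpha> * ((b - V2) / (\<alpha> + 1) - (b - z) / \<alpha>)
      else if V1 \<le> x \<and> x \<le> y \<and> y \<le> z \<and> z \<le> V2 then
        (V1 - a) powr \<alpha> * ((x - a) / \<alpha> - (V1 - a) / (\<alpha> + 1))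
        + 2 * (V2 - y) powr (\<alpha> + 1) / (\<alpha> * (\<alpha> + 1))
        + (V2 - V1) powr \<alpha> * ((V2 - V1) / (\<alpha> + 1) - (V2 - y) / \<alpha>)
        + (b - V2) powr \<alpha> * ((b - z) / \<alpha> - (b - V2) / (\<alpha> + 1))
      else if x \<le> V1 \<and> V1 \<le> V2 \<and> V2 \<le> y \<and> y \<le> z then
        2 * (x - a) powr (\<alpha> + 1) / (\<alpha> * (\<alpha> + 1))
        + (V1 - a) powr \<alpha> * ((V1 - a) / (\<alpha> + 1) - (x - a) / \<alpha>)
        + (V2 - V1) powr \<alpha> * ((y - V2) / \<alpha> + (V2 - V1) / (\<alpha> + 1))
        + 2 * (b - z) powr (\<alpha> + 1) / (\<alpha> * (\<alpha> + 1))
        + (b - V2) powr \<alpha> * ((b - V2) / (\<alpha> + 1) - (b - z) / \<alpha>)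
      else if x \<le> V1 \<and> V1 \<le> y \<and> y \<le> V2 \<and> V2 \<le> z then
        2 * (x - a) powr (\<alpha> + 1) / (\<alpha> * (\<alpha> + 1))
        + (V1 - a) powr \<alpha> * ((V1 - a) / (\<alpha> + 1) - (x - a) / \<alpha>)
        + 2 * (V2 - y) powr (\<alpha> + 1) / (\<alpha> * (\<alpha> + 1))
        + (V2 - V1) powr \<alpha> * ((V2 - V1) / (\<alpha> + 1) - (V2 - y) / \<alpha>)
        + 2 * (b - z) powr (\<alpha> + 1) / (\<alpha> * (\<alpha> + 1))
        + (b - V2) powr \<alpha> * ((b - V2) / (\<alpha> + 1) - (b - z) / \<alpha>)
      else if x \<le> V1 \<and> V1 \<le> y \<and> y \<le> z \<and> z \<le> V2 then
        2 * (x - a) powr (\<alpha> + 1) / (\<alpha> * (\<alpha> + 1))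
        + (V1 - a) powr \<alpha> * ((V1 - a) / (\<alpha> + 1) - (x - a) / \<alpha>)
        + 2 * (V2 - y) powr (\<alpha> + 1) / (\<alpha> * (\<alpha> + 1))
        + (V2 - V1) powr \<alpha> * ((V2 - V1) / (\<alpha> + 1) - (V2 - y) / \<alpha>)
        + (b - V2) powr \<alpha> * ((b - z) / \<alpha> - (b - V2) / (\<alpha> + 1))
      else if x \<le> y \<and> y \<le> V1 \<and> V1 \<le> V2 \<and> V2 \<le> z then
        2 * (x - a) powr (\<alpha> + 1) / (\<alpha> * (\<alpha> + 1))
        + (V1 - a) powr \<alpha> * ((V1 - a) / (\<alpha> + 1) - (x - a) / \<alpha>)
        + (V2 - V1) powr \<alpha> * ((V2 - y) / \<alpha> - (V2 - V1) / (\<alpha> + 1))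
        + 2 * (b - z) powr (\<alpha> + 1) / (\<alpha> * (\<alpha> + 1))
        + (b - V2) powr \<alpha> * ((b - V2) / (\<alpha> + 1) - (b - z) / \<alpha>)
      else if (x \<le> y \<and> y \<le> V1 \<and> V1 \<le> z \<and> z \<le> V2) \<or> (x \<le> y \<and> y \<le> z \<and> z \<le> V1 \<and> V1 \<le> V2) then
        2 * (x - a) powr (\<alpha> + 1) / (\<alpha> * (\<alpha> + 1))
        + (V1 - a) powr \<alpha> * ((V1 - a) / (\<alpha> + 1) - (x - a) / \<alpha>)
        + (V2 - V1) powr \<alpha> * ((V2 - y) / \<alpha> - (V2 - V1) / (\<alpha> + 1))
        + (b - V2) powr \<alpha> * ((b - z) / \<alpha> - (b - V2) / (\<alpha> + 1))
      else undefined)"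

lemma node_order:
  assumes "a < b" "0 \<le> lam" "0 \<le> \<eta>" "0 \<le> \<mu>" "lam + \<eta> + \<mu> = 1"
  shows "a \<le> node1 lam a b" "node1 lam a b \<le> node2 lam \<eta> \<mu> a b" "node2 lam \<eta> \<mu> a b \<le> b"
proof -
  have l: "lam = 1 - \<eta> - \<mu>"
    using assms(5) by simp
  have *: "node1 lam a b - a = lam * (b - a)" "b - node2 lam \<eta> \<mu> a b = \<mu> * (b - a)"
    "node2 lam \<eta> \<mu> a b - node1 lam a b = \<eta> * (b - a)"
    unfolding node1_def node2_def l by (simp_all add: algebra_simps)
  have "0 \<le> lam * (b - a)" "0 \<le> \<mu> * (b - a)" "0 \<le> \<eta> * (b - a)"
    using assms by auto
  then show "a \<le> node1 lam a b" "node1 lam a b \<le> node2 lam \<eta> \<mu> a b" "node2 lam \<eta> \<mu> a b \<le> b"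
    using * by linarith+
qed

lemma Vfun_boundary:
  fixes \<alpha> u :: real
  assumes "0 < \<alpha>" "0 \<le> u"
  shows "2 * u powr (\<alpha> + 1) / (\<alpha> * (\<alpha> + 1)) + u powr \<alpha> * (u / (\<alpha> + 1) - u / \<alpha>)
    = u powr \<alpha> * (u / \<alpha> - u / (\<alpha> + 1))"
proof -
  have *: "u powr (\<alpha> + 1) = u powr \<alpha> * u"
    using assms by (simp add: powr_add)
  show ?thesis
    unfolding * using assms(1) by (simp add: field_simps)
qed

lemma Vfun_cases:
  fixes \<alpha> lam \<eta> \<mu> a b x y z :: real
  defines "V1 \<equiv> node1 lam a b" and "V2 \<equiv> node2 lam \<eta> \<mu> a b"
  assumes "0 < \<alpha>" "a < b" "0 \<le> lam" "0 \<le> \<eta>" "0 \<le> \<mu>" "lam + \<eta> + \<mu> = 1"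
    and "a \<le> x" "x \<le> y" "y \<le> z" "z \<le> b"
  shows
    "(((V1 \<le> V2 \<and> V2 \<le> x \<and> x \<le> y \<and> y \<le> z) \<or> (V1 \<le> x \<and> x \<le> V2 \<and> V2 \<le> y \<and> y \<le> z)) \<longrightarrow> Vfun \<alpha> lam \<eta> \<mu> a b x y z =
        (V1 - a) powr \<alpha> * ((x - a) / \<alpha> - (V1 - a) / (\<alpha> + 1))
        + (V2 - V1) powr \<alpha> * ((y - V2) / \<alpha> + (V2 - V1) / (\<alpha> + 1))
        + 2 * (b - z) powr (\<alpha> + 1) / (\<alpha> * (\<alpha> + 1))
        + (b - V2) powr \<alpha> * ((b - V2) / (\<alpha> + 1) - (b - z) / \<alpha>))
      \<and> ((V1 \<le> x \<and> x \<le> y \<and> y \<le> V2 \<and> V2 \<le> z) \<longrightarrow> Vfun \<alpha> lam \<eta> \<mu> a b x y z =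
        (V1 - a) powr \<alpha> * ((x - a) / \<alpha> - (V1 - a) / (\<alpha> + 1))
        + 2 * (V2 - y) powr (\<alpha> + 1) / (\<alpha> * (\<alpha> + 1))
        + (V2 - V1) powr \<alpha> * ((V2 - V1) / (\<alpha> + 1) - (V2 - y) / \<alpha>)
        + 2 * (b - z) powr (\<alpha> + 1) / (\<alpha> * (\<alpha> + 1))
        + (b - V2) powr \<alpha> * ((b - V2) / (\<alpha> + 1) - (b - z) / \<alpha>))
      \<and> ((V1 \<le> x \<and> x \<le> y \<and> y \<le> z \<and> z \<le> V2) \<longrightarrow> Vfun \<alpha> lam \<eta> \<mu> a b x y z =
        (V1 - a) powr \<alpha> * ((x - a) / \<alpha> - (V1 - a) / (\<alpha> + 1))
        + 2 * (V2 - y) powr (\<alpha> + 1) / (\<alpha> * (\<alpha> + 1))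
        + (V2 - V1) powr \<alpha> * ((V2 - V1) / (\<alpha> + 1) - (V2 - y) / \<alpha>)
        + (b - V2) powr \<alpha> * ((b - z) / \<alpha> - (b - V2) / (\<alpha> + 1)))
      \<and> ((x \<le> V1 \<and> V1 \<le> V2 \<and> V2 \<le> y \<and> y \<le> z) \<longrightarrow> Vfun \<alpha> lam \<eta> \<mu> a b x y z =
        2 * (x - a) powr (\<alpha> + 1) / (\<alpha> * (\<alpha> + 1))
        + (V1 - a) powr \<alpha> * ((V1 - a) / (\<alpha> + 1) - (x - a) / \<alpha>)
        + (V2 - V1) powr \<alpha> * ((y - V2) / \<alpha> + (V2 - V1) / (\<alpha> + 1))
        + 2 * (b - z) powr (\<alpha> + 1) / (\<alpha> * (\<alpha> + 1))
        + (b - V2) powr \<alpha> * ((b - V2) / (\<alpha> + 1) - (b - z) / \<alpha>))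
      \<and> ((x \<le> V1 \<and> V1 \<le> y \<and> y \<le> V2 \<and> V2 \<le> z) \<longrightarrow> Vfun \<alpha> lam \<eta> \<mu> a b x y z =
        2 * (x - a) powr (\<alpha> + 1) / (\<alpha> * (\<alpha> + 1))
        + (V1 - a) powr \<alpha> * ((V1 - a) / (\<alpha> + 1) - (x - a) / \<alpha>)
        + 2 * (V2 - y) powr (\<alpha> + 1) / (\<alpha> * (\<alpha> + 1))
        + (V2 - V1) powr \<alpha> * ((V2 - V1) / (\<alpha> + 1) - (V2 - y) / \<alpha>)
        + 2 * (b - z) powr (\<alpha> + 1) / (\<alpha> * (\<alpha> + 1))
        + (b - V2) powr \<alpha> * ((b - V2) / (\<alpha> + 1) - (b - z) / \<alpha>))
      \<and> ((x \<le> V1 \<and> V1 \<le> y \<and> y \<le> z \<and> z \<le> V2) \<longrightarrow> Vfun \<alpha> lam \<eta> \<mu> a b x y z =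
        2 * (x - a) powr (\<alpha> + 1) / (\<alpha> * (\<alpha> + 1))
        + (V1 - a) powr \<alpha> * ((V1 - a) / (\<alpha> + 1) - (x - a) / \<alpha>)
        + 2 * (V2 - y) powr (\<alpha> + 1) / (\<alpha> * (\<alpha> + 1))
        + (V2 - V1) powr \<alpha> * ((V2 - V1) / (\<alpha> + 1) - (V2 - y) / \<alpha>)
        + (b - V2) powr \<alpha> * ((b - z) / \<alpha> - (b - V2) / (\<alpha> + 1)))
      \<and> ((x \<le> y \<and> y \<le> V1 \<and> V1 \<le> V2 \<and> V2 \<le> z) \<longrightarrow> Vfun \<alpha> lam \<eta> \<mu> a b x y z =
        2 * (x - a) powr (\<alpha> + 1) / (\<alpha> * (\<alpha> + 1))
        + (V1 - a) powr \<alpha> * ((V1 - a) / (\<alpha> + 1) - (x - a) / \<alpha>)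
        + (V2 - V1) powr \<alpha> * ((V2 - y) / \<alpha> - (V2 - V1) / (\<alpha> + 1))
        + 2 * (b - z) powr (\<alpha> + 1) / (\<alpha> * (\<alpha> + 1))
        + (b - V2) powr \<alpha> * ((b - V2) / (\<alpha> + 1) - (b - z) / \<alpha>))
      \<and> (((x \<le> y \<and> y \<le> V1 \<and> V1 \<le> z \<and> z \<le> V2) \<or> (x \<le> y \<and> y \<le> z \<and> z \<le> V1 \<and> V1 \<le> V2)) \<longrightarrow> Vfun \<alpha> lam \<eta> \<mu> a b x y z =
        2 * (x - a) powr (\<alpha> + 1) / (\<alpha> * (\<alpha> + 1))
        + (V1 - a) powr \<alpha> * ((V1 - a) / (\<alpha> + 1) - (x - a) / \<alpha>)
        + (V2 - V1) powr \<alpha> * ((V2 - y) / \<alpha> - (V2 - V1) / (\<alpha> + 1))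
        + (b - V2) powr \<alpha> * ((b - z) / \<alpha> - (b - V2) / (\<alpha> + 1)))"
proof -
  have o: "a \<le> V1" "V1 \<le> V2" "V2 \<le> b"
    using node_order assms unfolding V1_def V2_def by auto
  define A1 where "A1 = (V1 - a) powr \<alpha> * ((x - a) / \<alpha> - (V1 - a) / (\<alpha> + 1))"
  define A2 where "A2 = 2 * (x - a) powr (\<alpha> + 1) / (\<alpha> * (\<alpha> + 1))
        + (V1 - a) powr \<alpha> * ((V1 - a) / (\<alpha> + 1) - (x - a) / \<alpha>)"
  define B1 where "B1 = (V2 - V1) powr \<alpha> * ((y - V2) / \<alpha> + (V2 - V1) / (\<alpha> + 1))"
  define B2 where "B2 = 2 * (V2 - y) powr (\<alpha> + 1) / (\<alpha> * (\<alpha> + 1))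
        + (V2 - V1) powr \<alpha> * ((V2 - V1) / (\<alpha> + 1) - (V2 - y) / \<alpha>)"
  define B3 where "B3 = (V2 - V1) powr \<alpha> * ((V2 - y) / \<alpha> - (V2 - V1) / (\<alpha> + 1))"
  define C1 where "C1 = 2 * (b - z) powr (\<alpha> + 1) / (\<alpha> * (\<alpha> + 1))
        + (b - V2) powr \<alpha> * ((b - V2) / (\<alpha> + 1) - (b - z) / \<alpha>)"
  define C2 where "C2 = (b - V2) powr \<alpha> * ((b - z) / \<alpha> - (b - V2) / (\<alpha> + 1))"
  define v where "v = Vfun \<alpha> lam \<eta> \<mu> a b x y z"
  note defs = A1_def A2_def B1_def B2_def B3_def C1_def C2_def
  have A: "x = V1 \<Longrightarrow> A1 = A2"
    using Vfun_boundary[of \<alpha> "V1 - a"] assms(3) o by (simp add: defs)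
  have B: "y = V2 \<Longrightarrow> B1 = B2"
    using assms(3) by (simp add: defs)
  have B': "y = V1 \<Longrightarrow> B2 = B3"
    using Vfun_boundary[of \<alpha> "V2 - V1"] assms(3) o by (simp add: defs)
  have B'': "y = V1 \<Longrightarrow> y = V2 \<Longrightarrow> B1 = B3"
    by (simp add: defs)
  have C: "z = V2 \<Longrightarrow> C1 = C2"
    using Vfun_boundary[of \<alpha> "b - V2"] assms(3) o by (simp add: defs)
  have v: "v =
    (if (V1 \<le> V2 \<and> V2 \<le> x \<and> x \<le> y \<and> y \<le> z) \<or> (V1 \<le> x \<and> x \<le> V2 \<and> V2 \<le> y \<and> y \<le> z) then A1 + B1 + C1
    else if V1 \<le> x \<and> x \<le> y \<and> y \<le> V2 \<and> V2 \<le> z then A1 + B2 + C1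
    else if V1 \<le> x \<and> x \<le> y \<and> y \<le> z \<and> z \<le> V2 then A1 + B2 + C2
    else if x \<le> V1 \<and> V1 \<le> V2 \<and> V2 \<le> y \<and> y \<le> z then A2 + B1 + C1
    else if x \<le> V1 \<and> V1 \<le> y \<and> y \<le> V2 \<and> V2 \<le> z then A2 + B2 + C1
    else if x \<le> V1 \<and> V1 \<le> y \<and> y \<le> z \<and> z \<le> V2 then A2 + B2 + C2
    else if x \<le> y \<and> y \<le> V1 \<and> V1 \<le> V2 \<and> V2 \<le> z then A2 + B3 + C1
    else if (x \<le> y \<and> y \<le> V1 \<and> V1 \<le> z \<and> z \<le> V2) \<or> (x \<le> y \<and> y \<le> z \<and> z \<le> V1 \<and> V1 \<le> V2) then A2 + B3 + C2
    else undefined)"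
    unfolding v_def Vfun_def Let_def V1_def[symmetric] V2_def[symmetric] defs
    by (simp only: add.assoc)
  have "(((V1 \<le> V2 \<and> V2 \<le> x \<and> x \<le> y \<and> y \<le> z) \<or> (V1 \<le> x \<and> x \<le> V2 \<and> V2 \<le> y \<and> y \<le> z)) \<longrightarrow> v = A1 + B1 + C1)
      \<and> ((V1 \<le> x \<and> x \<le> y \<and> y \<le> V2 \<and> V2 \<le> z) \<longrightarrow> v = A1 + B2 + C1)
      \<and> ((V1 \<le> x \<and> x \<le> y \<and> y \<le> z \<and> z \<le> V2) \<longrightarrow> v = A1 + B2 + C2)
      \<and> ((x \<le> V1 \<and> V1 \<le> V2 \<and> V2 \<le> y \<and> y \<le> z) \<longrightarrow> v = A2 + B1 + C1)
      \<and> ((x \<le> V1 \<and> V1 \<le> y \<and> y \<le> V2 \<and> V2 \<le> z) \<longrightarrow> v = A2 + B2 + C1)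
      \<and> ((x \<le> V1 \<and> V1 \<le> y \<and> y \<le> z \<and> z \<le> V2) \<longrightarrow> v = A2 + B2 + C2)
      \<and> ((x \<le> y \<and> y \<le> V1 \<and> V1 \<le> V2 \<and> V2 \<le> z) \<longrightarrow> v = A2 + B3 + C1)
      \<and> (((x \<le> y \<and> y \<le> V1 \<and> V1 \<le> z \<and> z \<le> V2) \<or> (x \<le> y \<and> y \<le> z \<and> z \<le> V1 \<and> V1 \<le> V2)) \<longrightarrow> v = A2 + B3 + C2)"
    using v A B B' B'' C o assms(9-12) by (smt (verit))
  then show ?thesis
    unfolding v_def defs by (simp only: add.assoc)
qed

lemma Vfun_exhaustive:
  fixes V1 V2 x y z :: real
  assumes "x \<le> y" "y \<le> z" "V1 \<le> V2"
  shows "((V1 \<le> V2 \<and> V2 \<le> x \<and> x \<le> y \<and> y \<le> z) \<or> (V1 \<le> x \<and> x \<le> V2 \<and> V2 \<le> y \<and> y \<le> z))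
      \<or> (V1 \<le> x \<and> x \<le> y \<and> y \<le> V2 \<and> V2 \<le> z)
      \<or> (V1 \<le> x \<and> x \<le> y \<and> y \<le> z \<and> z \<le> V2)
      \<or> (x \<le> V1 \<and> V1 \<le> V2 \<and> V2 \<le> y \<and> y \<le> z)
      \<or> (x \<le> V1 \<and> V1 \<le> y \<and> y \<le> V2 \<and> V2 \<le> z)
      \<or> (x \<le> V1 \<and> V1 \<le> y \<and> y \<le> z \<and> z \<le> V2)
      \<or> (x \<le> y \<and> y \<le> V1 \<and> V1 \<le> V2 \<and> V2 \<le> z)
      \<or> ((x \<le> y \<and> y \<le> V1 \<and> V1 \<le> z \<and> z \<le> V2) \<or> (x \<le> y \<and> y \<le> z \<and> z \<le> V1 \<and> V1 \<le> V2))"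
  using assms linear[of V1 x] linear[of V2 x] linear[of V1 y] linear[of V2 y] linear[of V1 z] linear[of V2 z] by blast

(* The value printed in the source for both branches with y <= V1 is negative here,
   while the quantity it is supposed to bound is an absolute value. *)
lemma printed_sign_negative:
  fixes \<alpha> lam \<eta> \<mu> a b x y z :: real
  defines "\<alpha> \<equiv> 1" and "lam \<equiv> 1/10" and "\<eta> \<equiv> 8/10" and "\<mu> \<equiv> 1/10"
    and "a \<equiv> 0" and "b \<equiv> 1" and "x \<equiv> 1/20" and "y \<equiv> 1/20" and "z \<equiv> 9/10"
  defines "V1 \<equiv> node1 lam a b" and "V2 \<equiv> node2 lam \<eta> \<mu> a b"
  shows "x \<le> y \<and> y < V1 \<and> V1 < V2 \<and> V2 = z"
    and "2 * (x - a) powr (\<alpha> + 1) / (\<alpha> * (\<alpha> + 1))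
        + (V1 - a) powr \<alpha> * ((V1 - a) / (\<alpha> + 1) - (x - a) / \<alpha>)
        + (V2 - V1) powr \<alpha> * ((V2 - V1) / (\<alpha> + 1) - (V2 - y) / \<alpha>)
        + 2 * (b - z) powr (\<alpha> + 1) / (\<alpha> * (\<alpha> + 1))
        + (b - V2) powr \<alpha> * ((b - V2) / (\<alpha> + 1) - (b - z) / \<alpha>) < 0"
    and "2 * (x - a) powr (\<alpha> + 1) / (\<alpha> * (\<alpha> + 1))
        + (V1 - a) powr \<alpha> * ((V1 - a) / (\<alpha> + 1) - (x - a) / \<alpha>)
        + (V2 - V1) powr \<alpha> * ((V2 - V1) / (\<alpha> + 1) - (V2 - y) / \<alpha>)
        + (b - V2) powr \<alpha> * ((b - z) / \<alpha> - (b - V2) / (\<alpha> + 1)) < 0"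
  unfolding assms node1_def node2_def by (simp_all add: powr_numeral[of _ "Num.Bit0 Num.One", simplified] power2_eq_square)

end

theory Submission
  imports Defs
begin

text \<open>
  The weights \<open>lam powr \<alpha>\<close>, \<open>\<eta> powr \<alpha>\<close>, \<open>\<mu> powr \<alpha>\<close> are \<open>\<alpha> / (b - a) powr \<alpha>\<close> times the
  integrals of the three Riemann-Liouville kernels. So the left-hand side is a sum of three kernel
  integrals of \<open>f p - f t\<close> with \<open>p = x, y, z\<close>, and the Lipschitz condition bounds it by the kernel
  integrals of \<open>M * \<bar>t - p\<bar>\<close>. After moving the singular endpoint of each kernel to \<open>0\<close>, these
  are the values \<open>powr_kernel_moment \<alpha> L s\<close> of the integral of \<open>u powr (\<alpha> - 1) * \<bar>u - s\<bar>\<close> over \<open>{0..L}\<close>, and the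
  three shapes of this value (\<open>s \<le> 0\<close>, \<open>0 \<le> s \<le> L\<close>, \<open>L \<le> s\<close>) produce the cases of \<open>Vfun\<close>.
\<close>

section \<open>Lipschitz functions integrated against a nonnegative weight\<close>

text \<open>Since \<open>W * f p\<close> is the integral of \<open>w t * f p\<close>, the difference
  is the integral of \<open>w t * (f p - f t)\<close>, and the Lipschitz condition bounds the
  integrand pointwise. The point \<open>p\<close> ranges over all of \<open>I\<close> because
  \<open>x\<close>, \<open>y\<close>, \<open>z\<close> may lie outside the subinterval whose kernel
  they are paired with.\<close>

lemma weighted_lipschitz_bound:
  fixes f w :: "real \<Rightarrow> real"
  assumes lip: "M-lipschitz_on I f" and sub: "{c..d} \<subseteq> I" and p: "p \<in> I"
    and w: "(w has_integral W) {c..d}" and nonneg: "\<And>t. t \<in> {c..d} \<Longrightarrow> 0 \<le> w t"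
    and V: "((\<lambda>t. w t * \<bar>t - p\<bar>) has_integral V) {c..d}"
  shows "\<bar>W * f p - (LINT t:{c..d}|lebesgue. w t * f t)\<bar> \<le> M * V"
proof -
  have cont: "continuous_on {c..d} f"
    using lipschitz_on_continuous_on[OF lip] sub continuous_on_subset by blast
  \<comment> \<open>The kernels are unbounded at one endpoint when \<alpha> < 1, so integrability
    comes from nonnegativity rather than continuity. It survives multiplication by the bounded
    \<open>f\<close>, which identifies the Lebesgue integral with the gauge integral.\<close>
  have "w absolutely_integrable_on {c..d}"
    using w nonneg by (intro nonnegative_absolutely_integrable_1) auto
  then have "(\<lambda>t. f t * w t) absolutely_integrable_on {c..d}"
    using cont by (intro absolutely_integrable_bounded_measurable_product_real
        continuous_imp_measurable_on_sets_lebesgue)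
      (auto intro: compact_imp_bounded compact_continuous_image)
  then have wf: "(\<lambda>t. w t * f t) absolutely_integrable_on {c..d}"
    by (simp add: mult.commute)
  note eq = set_lebesgue_integral_eq_integral[OF wf]
  have diff: "((\<lambda>t. w t * f p - w t * f t) has_integral
      (W * f p - integral {c..d} (\<lambda>t. w t * f t))) {c..d}"
    by (intro has_integral_diff has_integral_mult_left[OF w] integrable_integral eq(1))
  have bound: "norm (w t * f p - w t * f t) \<le> w t * \<bar>t - p\<bar> * M" if t: "t \<in> {c..d}" for t
  proof -
    have "\<bar>f p - f t\<bar> \<le> M * \<bar>t - p\<bar>"
      using lipschitz_onD[OF lip p, of t] t sub
      by (auto simp: dist_real_def abs_minus_commute)
    then have "w t * \<bar>f p - f t\<bar> \<le> w t * (M * \<bar>t - p\<bar>)"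
      using nonneg[OF t] by (rule mult_left_mono)
    moreover have "norm (w t * f p - w t * f t) = w t * \<bar>f p - f t\<bar>"
      using nonneg[OF t] by (simp add: abs_mult flip: right_diff_distrib)
    ultimately show ?thesis
      by (simp add: mult_ac)
  qed
  have "norm (integral {c..d} (\<lambda>t. w t * f p - w t * f t))
      \<le> integral {c..d} (\<lambda>t. w t * \<bar>t - p\<bar> * M)"
    using diff has_integral_mult_left[OF V, of M] bound
    by (intro integral_norm_bound_integral) auto
  then show ?thesis
    unfolding integral_unique[OF diff] integral_unique[OF has_integral_mult_left[OF V, of M]] eq(2)
    by (simp add: mult.commute)
qed

section \<open>Closed forms of the kernel moments\<close>

definition powr_kernel_moment :: "real \<Rightarrow> real \<Rightarrow> real \<Rightarrow> real" where
  "powr_kernel_moment \<alpha> L s =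
    (if s \<le> 0 then L powr \<alpha> * (L / (\<alpha> + 1) - s / \<alpha>)
     else if s \<le> L then 2 * s powr (\<alpha> + 1) / (\<alpha> * (\<alpha> + 1)) + L powr \<alpha> * (L / (\<alpha> + 1) - s / \<alpha>)
     else L powr \<alpha> * (s / \<alpha> - L / (\<alpha> + 1)))"

lemma powr_kernel_moment_nonpos:
  "s \<le> 0 \<Longrightarrow> powr_kernel_moment \<alpha> L s = L powr \<alpha> * (L / (\<alpha> + 1) - s / \<alpha>)"
  by (simp add: powr_kernel_moment_def)

lemma powr_kernel_moment_between:
  "0 \<le> s \<Longrightarrow> s \<le> L \<Longrightarrow> powr_kernel_moment \<alpha> L s =
    2 * s powr (\<alpha> + 1) / (\<alpha> * (\<alpha> + 1)) + L powr \<alpha> * (L / (\<alpha> + 1) - s / \<alpha>)"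
  by (cases "s = 0") (simp_all add: powr_kernel_moment_def)

text \<open>At \<open>s = L\<close> the definition takes the middle branch, which
  \<open>Vfun_boundary\<close> turns into this one. The three evaluation rules thus hold on closed,
  overlapping ranges, like the regions of \<open>Vfun\<close>.\<close>

lemma powr_kernel_moment_ge:
  assumes "0 < \<alpha>" "0 \<le> L" "L \<le> s"
  shows "powr_kernel_moment \<alpha> L s = L powr \<alpha> * (s / \<alpha> - L / (\<alpha> + 1))"
proof (cases "L = s")
  case True
  then show ?thesis
    using powr_kernel_moment_between[of s L \<alpha>] Vfun_boundary[of \<alpha> s] assms by simp
next
  case False
  then show ?thesis
    using assms by (simp add: powr_kernel_moment_def)
qed

lemma has_integral_powr_kernel:
  fixes \<alpha> L :: real
  assumes "0 < \<alpha>" "0 \<le> L"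
  shows "((\<lambda>u. u powr (\<alpha> - 1)) has_integral L powr \<alpha> / \<alpha>) {0..L}"
  using has_integral_powr_from_0[of "\<alpha> - 1" L] assms by simp

lemma has_integral_powr_kernel_affine:
  fixes \<alpha> L s :: real
  assumes "0 < \<alpha>" "0 \<le> L"
  shows "((\<lambda>u. u powr (\<alpha> - 1) * (u - s)) has_integral L powr \<alpha> * (L / (\<alpha> + 1) - s / \<alpha>)) {0..L}"
proof -
  have "((\<lambda>u. u powr \<alpha> - u powr (\<alpha> - 1) * s) has_integral
      L powr (\<alpha> + 1) / (\<alpha> + 1) - L powr \<alpha> / \<alpha> * s) {0..L}"
    using assms by (intro has_integral_diff has_integral_mult_left has_integral_powr_kernel
        has_integral_powr_from_0) auto
  moreover have "L powr (\<alpha> + 1) / (\<alpha> + 1) - L powr \<alpha> / \<alpha> * s = L powr \<alpha> * (L / (\<alpha> + 1) - s / \<alpha>)"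
    using powr_mult_base[of L \<alpha>] assms(2) by (simp add: algebra_simps)
  \<comment> \<open>This includes \<open>u = 0\<close>, where both sides vanish because
    \<open>0 powr r = 0\<close> for every \<open>r\<close>.\<close>
  moreover have "u powr \<alpha> - u powr (\<alpha> - 1) * s = u powr (\<alpha> - 1) * (u - s)" if "u \<in> {0..L}" for u
    using powr_mult_base[of u "\<alpha> - 1"] that by (simp add: algebra_simps)
  ultimately show ?thesis
    by (metis (no_types, lifting) has_integral_eq)
qed

lemma has_integral_powr_kernel_moment:
  fixes \<alpha> L s :: real
  assumes \<alpha>: "0 < \<alpha>" and L: "0 \<le> L"
  shows "((\<lambda>u. u powr (\<alpha> - 1) * \<bar>u - s\<bar>) has_integral powr_kernel_moment \<alpha> L s) {0..L}"
proof -
  note aff = has_integral_powr_kernel_affine[OF \<alpha>]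
  consider "s \<le> 0" | "0 \<le> s" "s \<le> L" | "L \<le> s"
    by linarith
  then show ?thesis
  proof cases
    case 1
    have "((\<lambda>u. u powr (\<alpha> - 1) * \<bar>u - s\<bar>) has_integral L powr \<alpha> * (L / (\<alpha> + 1) - s / \<alpha>)) {0..L}"
      by (rule has_integral_eq[OF _ aff[OF L]]) (use 1 in auto)
    then show ?thesis
      using 1 by (simp add: powr_kernel_moment_nonpos)
  next
    case 2
    \<comment> \<open>The absolute value \<open>\<bar>u - s\<bar>\<close> is \<open>u - s\<close>
      plus the correction \<open>-2 * (u - s)\<close> on \<open>{0..s}\<close>. Extending the
      correction by zero lets both integrals live on \<open>{0..L}\<close>.\<close>
    let ?h = "\<lambda>u. if u \<in> {0..s} then -2 * (u powr (\<alpha> - 1) * (u - s)) else 0"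
    have "(?h has_integral -2 * (s powr \<alpha> * (s / (\<alpha> + 1) - s / \<alpha>))) {0..L}"
      using 2 by (subst has_integral_restrict, simp) (intro has_integral_mult_right aff)
    from has_integral_add[OF aff[OF L, of s] this]
    have "((\<lambda>u. u powr (\<alpha> - 1) * \<bar>u - s\<bar>) has_integral
        L powr \<alpha> * (L / (\<alpha> + 1) - s / \<alpha>) + -2 * (s powr \<alpha> * (s / (\<alpha> + 1) - s / \<alpha>))) {0..L}"
      by (rule has_integral_eq[rotated]) (auto simp: algebra_simps)
    moreover have "-2 * (s powr \<alpha> * (s / (\<alpha> + 1) - s / \<alpha>)) = 2 * s powr (\<alpha> + 1) / (\<alpha> * (\<alpha> + 1))"
    proof -
      have *: "s powr (\<alpha> + 1) = s powr \<alpha> * s"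
        using powr_mult_base[of s \<alpha>] 2 by (simp add: mult.commute add.commute)
      show ?thesis
        unfolding * using \<alpha> by (simp add: field_simps)
    qed
    ultimately show ?thesis
      using 2 by (simp only: powr_kernel_moment_between add.commute)
  next
    case 3
    have "((\<lambda>u. u powr (\<alpha> - 1) * \<bar>u - s\<bar>) has_integral - (L powr \<alpha> * (L / (\<alpha> + 1) - s / \<alpha>))) {0..L}"
      by (rule has_integral_eq[OF _ has_integral_neg[OF aff[OF L]]]) (use 3 in \<open>auto simp: abs_if algebra_simps\<close>)
    then show ?thesis
      using 3 \<alpha> L by (simp add: powr_kernel_moment_ge algebra_simps)
  qed
qed

section \<open>Error bounds for a single fractional integral\<close>

text \<open>By \<open>Gamma (\<alpha> + 1) = \<alpha> * Gamma \<alpha>\<close> the normalisation of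
  the fractional integral cancels up to a factor \<alpha>, the one in front of the final
  bound.\<close>

lemma Gamma_kernel_scaling:
  fixes \<alpha> F J K M W :: real
  assumes "0 < \<alpha>" and bound: "\<bar>W / \<alpha> * F - J\<bar> \<le> M * K"
  shows "\<bar>W * F - Gamma (\<alpha> + 1) * (1 / Gamma \<alpha> * J)\<bar> \<le> \<alpha> * M * K"
proof -
  have "\<alpha> \<notin> \<int>\<^sub>\<le>\<^sub>0"
    using assms(1) nonpos_Ints_nonpos[of \<alpha>] by auto
  then have "Gamma (\<alpha> + 1) * (1 / Gamma \<alpha> * J) = \<alpha> * J"
    using Gamma_real_pos[OF assms(1)] by (simp add: Gamma_plus1)
  then have "\<bar>W * F - Gamma (\<alpha> + 1) * (1 / Gamma \<alpha> * J)\<bar> = \<bar>\<alpha> * (W / \<alpha> * F - J)\<bar>"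
    using assms(1) by (simp add: right_diff_distrib)
  also have "\<dots> = \<alpha> * \<bar>W / \<alpha> * F - J\<bar>"
    using assms(1) by (simp add: abs_mult)
  also have "\<dots> \<le> \<alpha> * (M * K)"
    using assms by simp
  finally show ?thesis
    by (simp add: mult.assoc)
qed

text \<open>The shift \<open>u = t - c\<close> sends the singular endpoint to 0 and \<open>p\<close>
  to \<open>p - c\<close>. Equality \<open>c = d\<close> is allowed since nodes coincide with each
  other or with \<open>a\<close>, \<open>b\<close> when a weight is 0.\<close>

lemma RL_right_lipschitz_bound:
  assumes lip: "M-lipschitz_on I f" and sub: "{c..d} \<subseteq> I" and p: "p \<in> I"
    and \<alpha>: "0 < \<alpha>" and cd: "c \<le> d"
  shows "\<bar>(d - c) powr \<alpha> * f p - Gamma (\<alpha> + 1) * RL_right \<alpha> d f c\<bar>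
    \<le> \<alpha> * M * powr_kernel_moment \<alpha> (d - c) (p - c)"
proof -
  let ?J = "LINT t:{c..d}|lebesgue. (t - c) powr (\<alpha> - 1) * f t"
  have L: "0 \<le> d - c"
    using cd by simp
  have "((\<lambda>t. (t - c) powr (\<alpha> - 1)) has_integral (d - c) powr \<alpha> / \<alpha>) {c..d}"
    using has_integral_shift_real_ivl[OF has_integral_powr_kernel[OF \<alpha> L], of "-c"] by simp
  moreover have "((\<lambda>t. (t - c) powr (\<alpha> - 1) * \<bar>t - p\<bar>) has_integral
      powr_kernel_moment \<alpha> (d - c) (p - c)) {c..d}"
    using has_integral_shift_real_ivl[OF has_integral_powr_kernel_moment[OF \<alpha> L, of "p - c"], of "-c"]
    by simp
  ultimately have "\<bar>(d - c) powr \<alpha> / \<alpha> * f p - ?J\<bar> \<le> M * powr_kernel_moment \<alpha> (d - c) (p - c)"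
    by (intro weighted_lipschitz_bound[OF lip sub p]) auto
  then show ?thesis
    unfolding RL_right_def by (rule Gamma_kernel_scaling[OF \<alpha>])
qed

lemma RL_left_lipschitz_bound:
  assumes lip: "M-lipschitz_on I f" and sub: "{c..d} \<subseteq> I" and p: "p \<in> I"
    and \<alpha>: "0 < \<alpha>" and cd: "c \<le> d"
  shows "\<bar>(d - c) powr \<alpha> * f p - Gamma (\<alpha> + 1) * RL_left \<alpha> c f d\<bar>
    \<le> \<alpha> * M * powr_kernel_moment \<alpha> (d - c) (d - p)"
proof -
  let ?J = "LINT t:{c..d}|lebesgue. (d - t) powr (\<alpha> - 1) * f t"
  have L: "0 \<le> d - c"
    using cd by simp
  \<comment> \<open>Here the singularity sits at \<open>d\<close>, so the substitution is
    \<open>u = d - t\<close>, done as a shift followed by a reflection; it sends \<open>p\<close> to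
    \<open>d - p\<close>.\<close>
  have reflect: "((\<lambda>t. g (d - t)) has_integral v) {c..d}"
    if "(g has_integral v) {0..d - c}" for g :: "real \<Rightarrow> real" and v
  proof -
    have "((\<lambda>t. g (t + d)) has_integral v) {- d..- c}"
      using has_integral_shift_real_ivl[OF that, of d] by simp
    then have "((\<lambda>t. g (- t + d)) has_integral v) {c..d}"
      using has_integral_reflect_real[of "\<lambda>t. g (t + d)" v "- c" "- d"] by simp
    then show ?thesis
      by simp
  qed
  have "((\<lambda>t. (d - t) powr (\<alpha> - 1)) has_integral (d - c) powr \<alpha> / \<alpha>) {c..d}"
    using reflect[OF has_integral_powr_kernel[OF \<alpha> L]] .
  moreover have "((\<lambda>t. (d - t) powr (\<alpha> - 1) * \<bar>t - p\<bar>) has_integral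
      powr_kernel_moment \<alpha> (d - c) (d - p)) {c..d}"
    using reflect[OF has_integral_powr_kernel_moment[OF \<alpha> L, of "d - p"]]
    by (simp add: abs_minus_commute)
  ultimately have "\<bar>(d - c) powr \<alpha> / \<alpha> * f p - ?J\<bar> \<le> M * powr_kernel_moment \<alpha> (d - c) (d - p)"
    by (intro weighted_lipschitz_bound[OF lip sub p]) auto
  then show ?thesis
    unfolding RL_left_def by (rule Gamma_kernel_scaling[OF \<alpha>])
qed

section \<open>Combining the three kernels\<close>

text \<open>The three moments vary independently: \<open>x\<close> against \<open>V1\<close> fixes
  the shape of the first, \<open>y\<close> against \<open>V1\<close> and \<open>V2\<close> that of
  the second, \<open>z\<close> against \<open>V2\<close> that of the third. As \<open>x - a\<close>
  and \<open>b - z\<close> are nonnegative, the outer moments need two shapes each, the middle one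
  all three.\<close>

lemma Vfun_eq_powr_kernel_moments:
  fixes \<alpha> lam \<eta> \<mu> a b x y z :: real
  defines "V1 \<equiv> node1 lam a b" and "V2 \<equiv> node2 lam \<eta> \<mu> a b"
  assumes "0 < \<alpha>" "a < b" "0 \<le> lam" "0 \<le> \<eta>" "0 \<le> \<mu>" "lam + \<eta> + \<mu> = 1"
    and "a \<le> x" "x \<le> y" "y \<le> z" "z \<le> b"
  shows "Vfun \<alpha> lam \<eta> \<mu> a b x y z = powr_kernel_moment \<alpha> (V1 - a) (x - a)
    + powr_kernel_moment \<alpha> (V2 - V1) (V2 - y) + powr_kernel_moment \<alpha> (b - V2) (b - z)"
proof -
  have o: "a \<le> V1" "V1 \<le> V2" "V2 \<le> b"
    using node_order assms unfolding V1_def V2_def by auto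
  have KA: "V1 \<le> x \<Longrightarrow>
      (V1 - a) powr \<alpha> * ((x - a) / \<alpha> - (V1 - a) / (\<alpha> + 1)) = powr_kernel_moment \<alpha> (V1 - a) (x - a)"
    "x \<le> V1 \<Longrightarrow> 2 * (x - a) powr (\<alpha> + 1) / (\<alpha> * (\<alpha> + 1))
      + (V1 - a) powr \<alpha> * ((V1 - a) / (\<alpha> + 1) - (x - a) / \<alpha>) = powr_kernel_moment \<alpha> (V1 - a) (x - a)"
    using assms(3,9) o by (simp_all add: powr_kernel_moment_ge powr_kernel_moment_between)
  \<comment> \<open>The leading summand \<open>c\<close> lets the left-associated sums of \<open>Vfun\<close> match.\<close>
  have KB: "V2 \<le> y \<Longrightarrow>
      (V2 - V1) powr \<alpha> * ((y - V2) / \<alpha> + (V2 - V1) / (\<alpha> + 1)) = powr_kernel_moment \<alpha> (V2 - V1) (V2 - y)"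
    "V1 \<le> y \<Longrightarrow> y \<le> V2 \<Longrightarrow> c + 2 * (V2 - y) powr (\<alpha> + 1) / (\<alpha> * (\<alpha> + 1))
      + (V2 - V1) powr \<alpha> * ((V2 - V1) / (\<alpha> + 1) - (V2 - y) / \<alpha>)
      = c + powr_kernel_moment \<alpha> (V2 - V1) (V2 - y)"
    "y \<le> V1 \<Longrightarrow>
      (V2 - V1) powr \<alpha> * ((V2 - y) / \<alpha> - (V2 - V1) / (\<alpha> + 1)) = powr_kernel_moment \<alpha> (V2 - V1) (V2 - y)"
    for c
    using assms(3) o
    by (simp_all add: powr_kernel_moment_nonpos powr_kernel_moment_between powr_kernel_moment_ge
        diff_divide_distrib)
  have KC: "V2 \<le> z \<Longrightarrow> c + 2 * (b - z) powr (\<alpha> + 1) / (\<alpha> * (\<alpha> + 1))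
      + (b - V2) powr \<alpha> * ((b - V2) / (\<alpha> + 1) - (b - z) / \<alpha>)
      = c + powr_kernel_moment \<alpha> (b - V2) (b - z)"
    "z \<le> V2 \<Longrightarrow>
      (b - V2) powr \<alpha> * ((b - z) / \<alpha> - (b - V2) / (\<alpha> + 1)) = powr_kernel_moment \<alpha> (b - V2) (b - z)"
    for c
    using assms(3,12) o by (simp_all add: powr_kernel_moment_ge powr_kernel_moment_between)
  \<comment> \<open>A region of \<open>Vfun\<close> does not state every comparison that
    \<open>KA\<close>, \<open>KB\<close> and \<open>KC\<close> ask for; these implications supply
    the rest.\<close>
  have chain: "V1 \<le> x \<Longrightarrow> V1 \<le> y" "V2 \<le> y \<Longrightarrow> V2 \<le> z" "z \<le> V2 \<Longrightarrow> y \<le> V2" "y \<le> V1 \<Longrightarrow> x \<le> V1"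
    "V2 \<le> x \<Longrightarrow> V1 \<le> x" "V2 \<le> x \<Longrightarrow> V2 \<le> y" "z \<le> V1 \<Longrightarrow> z \<le> V2" "z \<le> V1 \<Longrightarrow> y \<le> V1"
    using o assms(10,11) by linarith+
  from Vfun_exhaustive[OF assms(10,11) o(2)] show ?thesis
    using Vfun_cases[OF assms(3-12), folded V1_def V2_def]
    by (elim disjE conjE) (simp_all only: KA KB KC chain assms(10,11) o simp_thms)
qed

theorem theorem6:
  fixes I :: "real set" and f :: "real \<Rightarrow> real"
    and a b x y z M \<alpha> lam \<eta> \<mu> :: real
  assumes "is_interval I" and "a \<in> I" and "b \<in> I" and "0 \<le> a" and "a < b"
    and "a \<le> x" and "x \<le> y" and "y \<le> z" and "z \<le> b"
    and "M-lipschitz_on I f"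
    and "\<alpha> > 0"
    and "lam \<in> {0..1}" and "\<eta> \<in> {0..1}" and "\<mu> \<in> {0..1}" and "lam + \<eta> + \<mu> = 1"
  shows "let V1 = node1 lam a b; V2 = node2 lam \<eta> \<mu> a b in
    \<bar>lam powr \<alpha> * f x + \<eta> powr \<alpha> * f y + \<mu> powr \<alpha> * f z
      - Gamma (\<alpha> + 1) / (b - a) powr \<alpha>
        * (RL_right \<alpha> V1 f a + RL_left \<alpha> V1 f V2 + RL_left \<alpha> V2 f b)\<bar>
    \<le> \<alpha> * M * Vfun \<alpha> lam \<eta> \<mu> a b x y z / (b - a) powr \<alpha>"
proof -
  define V1 where "V1 = node1 lam a b"
  define V2 where "V2 = node2 lam \<eta> \<mu> a b"
  define B where "B = (b - a) powr \<alpha>"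
  let ?G = "Gamma (\<alpha> + 1)"
  let ?RA = "RL_right \<alpha> V1 f a" and ?RB = "RL_left \<alpha> V1 f V2" and ?RC = "RL_left \<alpha> V2 f b"
  let ?KA = "powr_kernel_moment \<alpha> (V1 - a) (x - a)"
    and ?KB = "powr_kernel_moment \<alpha> (V2 - V1) (V2 - y)"
    and ?KC = "powr_kernel_moment \<alpha> (b - V2) (b - z)"
  have w: "0 \<le> lam" "0 \<le> \<eta>" "0 \<le> \<mu>"
    using assms(12-14) by auto
  have o: "a \<le> V1" "V1 \<le> V2" "V2 \<le> b"
    using node_order[OF assms(5) w assms(15)] unfolding V1_def V2_def by auto
  have sub: "{a..b} \<subseteq> I"
    by (meson assms(1-3) atLeastAtMost_iff mem_is_interval_1_I subsetI)
  have B: "0 < B"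
    using assms(5) by (simp add: B_def)
  have lam: "lam = 1 - \<eta> - \<mu>"
    using assms(15) by simp
  \<comment> \<open>The nodes cut \<open>[a, b]\<close> in the proportions \<open>lam\<close>,
    \<eta>, \<mu>, so the weights times \<open>B\<close> are the powers of lengths in the one-kernel
    bounds.\<close>
  have "V1 - a = lam * (b - a)" "V2 - V1 = \<eta> * (b - a)" "b - V2 = \<mu> * (b - a)"
    unfolding V1_def V2_def node1_def node2_def lam by (simp_all add: algebra_simps)
  then have powr: "(V1 - a) powr \<alpha> = lam powr \<alpha> * B" "(V2 - V1) powr \<alpha> = \<eta> powr \<alpha> * B"
    "(b - V2) powr \<alpha> = \<mu> powr \<alpha> * B"
    using w assms(5) by (simp_all add: powr_mult B_def)
  have "\<bar>(V1 - a) powr \<alpha> * f x - ?G * ?RA\<bar> \<le> \<alpha> * M * ?KA"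
    using sub o assms(5-9,11) by (intro RL_right_lipschitz_bound[OF assms(10)]) auto
  moreover have "\<bar>(V2 - V1) powr \<alpha> * f y - ?G * ?RB\<bar> \<le> \<alpha> * M * ?KB"
    using sub o assms(5-9,11) by (intro RL_left_lipschitz_bound[OF assms(10)]) auto
  moreover have "\<bar>(b - V2) powr \<alpha> * f z - ?G * ?RC\<bar> \<le> \<alpha> * M * ?KC"
    using sub o assms(5-9,11) by (intro RL_left_lipschitz_bound[OF assms(10)]) auto
  ultimately have "\<bar>lam powr \<alpha> * B * f x + \<eta> powr \<alpha> * B * f y + \<mu> powr \<alpha> * B * f z
      - (?G * ?RA + ?G * ?RB + ?G * ?RC)\<bar> \<le> \<alpha> * M * ?KA + \<alpha> * M * ?KB + \<alpha> * M * ?KC"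
    unfolding powr by linarith
  also have "\<dots> = \<alpha> * M * Vfun \<alpha> lam \<eta> \<mu> a b x y z"
    using Vfun_eq_powr_kernel_moments[OF assms(11,5) w assms(15,6-9)]
    by (simp add: V1_def V2_def distrib_left)
  finally have main: "\<bar>lam powr \<alpha> * B * f x + \<eta> powr \<alpha> * B * f y + \<mu> powr \<alpha> * B * f z
      - (?G * ?RA + ?G * ?RB + ?G * ?RC)\<bar> \<le> \<alpha> * M * Vfun \<alpha> lam \<eta> \<mu> a b x y z" .
  \<comment> \<open>Dividing \<open>main\<close> by the positive \<open>B\<close> restores the
    normalisation of the claim.\<close>
  have "lam powr \<alpha> * f x + \<eta> powr \<alpha> * f y + \<mu> powr \<alpha> * f z - ?G / B * (?RA + ?RB + ?RC)
      = (lam powr \<alpha> * B * f x + \<eta> powr \<alpha> * B * f y + \<mu> powr \<alpha> * B * f z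
        - (?G * ?RA + ?G * ?RB + ?G * ?RC)) / B"
    using B by (simp add: field_simps)
  then have "\<bar>lam powr \<alpha> * f x + \<eta> powr \<alpha> * f y + \<mu> powr \<alpha> * f z - ?G / B * (?RA + ?RB + ?RC)\<bar>
      \<le> \<alpha> * M * Vfun \<alpha> lam \<eta> \<mu> a b x y z / B"
    using main B by (simp add: divide_right_mono)
  then show ?thesis
    by (simp add: Let_def V1_def V2_def B_def)
qed

end
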